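(* Let $G$ be a finite simple, undirected, connected graph on $n$ vertices with positive edge weights, with weighted Laplacian $L$ having eigenvalues $\lambda_1,\dots,\lambda_n$ (counted with multiplicity), weighted vertex degrees $d_1,\dots,d_n$ and degree matrix $D=\mathrm{diag}(d_1,\dots,d_n)$. If $g:\mathbb{R}^2\to\mathbb{R}$ is analytic, then there exists an analytic function $\tilde g$ (which may depend on $G$ and its weights) such that $$\sum_{i,j=1}^n g(\lambda_i,\lambda_j)\le\sum_{i,j=1}^n\tilde g(d_i,d_j).$$ In particular, if $$g(x,y)=\sum_{k=0}^{\infty}\frac{a_k}{k!}(x-y)^k\qquad (x,y\in\mathbb{R})$$ with real coefficients $a_k$ such that $a_{2k}\ge 0$ for every $k\ge 1$, then the inequality holds with $$\tilde g(d_i,d_j)=a_0+2\sum_{k=1}^{\infty}\frac{a_{2k}}{(2k)!}\,\lambda_{\max}(L)^{2k-2}\left[(d_i-d_j)^2+\frac{\mathrm{tr}(D)^2}{n^2}\right].$$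
   Context: For a weighted graph with symmetric weighted adjacency matrix $A$ ($A_{ij}=w_{ij}>0$ if $ij$ is an edge, $0$ otherwise, $A_{ii}=0$), the weighted degree of vertex $i$ is $d_i=\sum_jA_{ij}$, $D=\mathrm{diag}(d_1,\dots,d_n)$, and $L=D-A$. $\lambda_{\max}(L)$ is the largest eigenvalue of $L$. The convention $0^0=1$ is used. *)

theory Defs
  imports
    "HOL-Analysis.Infinite_Sum"
    "Graph_Theory.Digraph_Component"
    "Jordan_Normal_Form.Spectral_Radius"
begin

text \<open>
  A finite simple undirected graph is a \<open>pair_graph\<close>: a loopfree digraph with a finite, symmetric
  arc set. The value of a weight function \<open>w\<close> matters only on arcs.
\<close>

definition adjacency_mat :: "nat \<Rightarrow> nat pair_pre_digraph \<Rightarrow> (nat \<Rightarrow> nat \<Rightarrow> real) \<Rightarrow> real mat" where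
  "adjacency_mat n G w = mat n n (\<lambda>(i, j). if (i, j) \<in> parcs G then w i j else 0)"

definition wdegree :: "nat \<Rightarrow> nat pair_pre_digraph \<Rightarrow> (nat \<Rightarrow> nat \<Rightarrow> real) \<Rightarrow> nat \<Rightarrow> real" where
  "wdegree n G w i = (\<Sum>j<n. adjacency_mat n G w $$ (i, j))"

definition degree_mat :: "nat \<Rightarrow> nat pair_pre_digraph \<Rightarrow> (nat \<Rightarrow> nat \<Rightarrow> real) \<Rightarrow> real mat" where
  "degree_mat n G w = mat_diag n (wdegree n G w)"

definition laplacian :: "nat \<Rightarrow> nat pair_pre_digraph \<Rightarrow> (nat \<Rightarrow> nat \<Rightarrow> real) \<Rightarrow> real mat" where
  "laplacian n G w = degree_mat n G w - adjacency_mat n G w"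

definition tr :: "real mat \<Rightarrow> real" where
  "tr M = (\<Sum>i<dim_row M. M $$ (i, i))"

definition lambda_max :: "real mat \<Rightarrow> real" where
  "lambda_max M = Max (spectrum M)"

text \<open>
  Real analyticity of a function on the whole plane: near every point it is the sum of an
  (unconditionally) convergent double power series centred at that point.
\<close>

definition real_analytic2 :: "(real \<times> real \<Rightarrow> real) \<Rightarrow> bool" where
  "real_analytic2 f \<longleftrightarrow>
    (\<forall>x0 y0. \<exists>c r. r > 0 \<and>
      (\<forall>x y. \<bar>x - x0\<bar> < r \<longrightarrow> \<bar>y - y0\<bar> < r \<longrightarrow>
        ((\<lambda>(i::nat, j::nat). c i j * (x - x0) ^ i * (y - y0) ^ j) has_sum f (x, y)) UNIV))"

end

theory Submission
  imports Defs
begin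

text \<open>
  For the second claim, sum the series of \<open>g\<close> over all pairs of eigenvalues: odd powers cancel by
  symmetry. The eigenvalues lie in \<open>[0, \<lambda>]\<close> with \<open>\<lambda> = lambda_max L\<close>, so
  \<open>(\<lambda>\<^sub>i - \<lambda>\<^sub>j)^(2k) \<le> \<lambda>^(2k-2) (\<lambda>\<^sub>i - \<lambda>\<^sub>j)^2\<close>. The quadratic sum is a trace expression:
  with \<open>\<Sum> \<lambda>\<^sub>i = tr L = \<Sum> d\<^sub>i\<close> and \<open>\<Sum> \<lambda>\<^sub>i^2 = tr (L^2) = \<Sum> d\<^sub>i^2 + \<Sum> A\<^sub>i\<^sub>j^2\<close> the required bound
  reduces to \<open>\<Sum> A\<^sub>i\<^sub>j^2 \<le> \<Sum> d\<^sub>i^2\<close>, which holds since the entries of \<open>A\<close> are nonnegative.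
  For the first claim a constant \<open>g'\<close> suffices.
\<close>

section \<open>Eigenvalues and traces\<close>

lemma tr_mult_commute:
  assumes "A \<in> carrier_mat n m" "B \<in> carrier_mat m n"
  shows "tr (A * B) = tr (B * A)"
proof -
  have "tr (A * B) = (\<Sum>i<n. \<Sum>j<m. A $$ (i, j) * B $$ (j, i))"
    using assms by (auto simp: tr_def scalar_prod_def atLeast0LessThan intro!: sum.cong)
  also have "\<dots> = (\<Sum>j<m. \<Sum>i<n. B $$ (j, i) * A $$ (i, j))"
    by (subst sum.swap) (simp add: mult.commute)
  also have "\<dots> = tr (B * A)"
    using assms by (auto simp: tr_def scalar_prod_def atLeast0LessThan intro!: sum.cong)
  finally show ?thesis .
qed

lemma tr_conjugate:
  assumes "P \<in> carrier_mat n n" "X \<in> carrier_mat n n" "Q \<in> carrier_mat n n" "Q * P = 1\<^sub>m n"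
  shows "tr (P * X * Q) = tr X"
proof -
  have "tr (P * X * Q) = tr (Q * (P * X))"
    using assms by (intro tr_mult_commute[of _ n n]) auto
  also have "Q * (P * X) = (Q * P) * X"
    using assms by (intro assoc_mult_mat[symmetric, of _ n n _ n _ n]) auto
  also have "\<dots> = X" using assms by simp
  finally show ?thesis .
qed

text \<open>The characteristic polynomial splits over the reals, so a Schur decomposition makes
  \<open>L\<close> similar to an upper triangular \<open>B\<close> whose diagonal lists the
  \<open>ev i\<close>; similarity preserves both traces.\<close>

lemma
  fixes L :: "real mat"
  assumes L: "L \<in> carrier_mat n n"
    and ev: "char_poly L = (\<Prod>i<n. [:- ev i, 1:])"
  shows sum_eigenvalues_eq_tr: "(\<Sum>i<n. ev i) = tr L"
    and sum_eigenvalues_sq_eq_tr: "(\<Sum>i<n. (ev i)\<^sup>2) = tr (L * L)"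
proof -
  define es where "es = map ev [0..<n]"
  have "char_poly L = (\<Prod>e\<leftarrow>es. [:- e, 1:])"
    unfolding ev es_def by (simp add: prod.list_conv_set_nth atLeast0LessThan)
  moreover obtain B P Q where "schur_decomposition L es = (B, P, Q)"
    by (cases "schur_decomposition L es") auto
  ultimately have sim: "similar_mat_wit L B P Q" and ut: "upper_triangular B"
    and diag: "diag_mat B = es"
    using schur_decomposition[OF L] by blast+
  note w = similar_mat_witD2[OF L sim]
  have dB: "B $$ (i, i) = ev i" if "i < n" for i
  proof -
    have "diag_mat B ! i = es ! i" by (simp add: diag)
    thus ?thesis using that w(5) by (simp add: es_def diag_mat_def)
  qed
  have "tr L = tr B" unfolding w(3) using w by (intro tr_conjugate) auto
  also have "\<dots> = (\<Sum>i<n. ev i)" using w(5) dB by (auto simp: tr_def intro!: sum.cong)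
  finally show "(\<Sum>i<n. ev i) = tr L" by simp
  have "L * L = P * B * (Q * (P * (B * Q)))"
    unfolding w(3) using w by (simp add: assoc_mult_mat[of _ n n _ n _ n])
  also have "Q * (P * (B * Q)) = (Q * P) * (B * Q)"
    using w by (intro assoc_mult_mat[symmetric, of _ n n _ n _ n]) auto
  also have "\<dots> = B * Q" using w by simp
  also have "P * B * (B * Q) = P * (B * B) * Q"
    using w by (simp add: assoc_mult_mat[of _ n n _ n _ n])
  finally have "tr (L * L) = tr (B * B)" using w by (simp add: tr_conjugate)
  also have "\<dots> = (\<Sum>i<n. \<Sum>j<n. B $$ (i, j) * B $$ (j, i))"
    using w(5) by (auto simp: tr_def scalar_prod_def atLeast0LessThan intro!: sum.cong)
  also have "\<dots> = (\<Sum>i<n. (ev i)\<^sup>2)"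
  proof (rule sum.cong[OF refl])
    fix i assume i: "i \<in> {..<n}"
    \<comment> \<open>Off the diagonal, one of the two factors lies below the diagonal of
      \<open>B\<close> and vanishes.\<close>
    have "B $$ (i, j) * B $$ (j, i) = (if j = i then (ev i)\<^sup>2 else 0)" if "j < n" for j
    proof (cases i j rule: linorder_cases)
      case less
      thus ?thesis using ut w(5) that by (auto simp: upper_triangular_def)
    next
      case equal
      thus ?thesis using dB that by (simp add: power2_eq_square)
    next
      case greater
      thus ?thesis using ut w(5) i by (auto simp: upper_triangular_def)
    qed
    thus "(\<Sum>j<n. B $$ (i, j) * B $$ (j, i)) = (ev i)\<^sup>2" using i by simp
  qed
  finally show "(\<Sum>i<n. (ev i)\<^sup>2) = tr (L * L)" by simp
qed

lemma spectrum_eq_image: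
  fixes L :: "real mat"
  assumes "L \<in> carrier_mat n n" "char_poly L = (\<Prod>i<n. [:- ev i, 1:])"
  shows "spectrum L = ev ` {..<n}"
  unfolding spectrum_root_char_poly[OF assms(1)] assms(2) by (auto simp: poly_prod)

text \<open>With the row sums of \<open>A\<close> as degrees, this is the quadratic form of the
  Laplacian. Exchanging \<open>i\<close> and \<open>j\<close> and averaging makes it half the sum of
  \<open>A i j * (v i - v j)^2\<close>.\<close>

lemma laplacian_form_nonneg:
  fixes A :: "'a \<Rightarrow> 'a \<Rightarrow> real"
  assumes "\<And>i j. i \<in> V \<Longrightarrow> j \<in> V \<Longrightarrow> A i j \<ge> 0"
    and sym: "\<And>i j. i \<in> V \<Longrightarrow> j \<in> V \<Longrightarrow> A i j = A j i"
  shows "0 \<le> (\<Sum>i\<in>V. \<Sum>j\<in>V. A i j * ((v i)\<^sup>2 - v i * v j))" (is "0 \<le> ?S")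
proof -
  have "?S = (\<Sum>i\<in>V. \<Sum>j\<in>V. A i j * ((v j)\<^sup>2 - v i * v j))"
    by (subst sum.swap) (auto intro!: sum.cong simp: sym mult.commute)
  hence "2 * ?S = ?S + (\<Sum>i\<in>V. \<Sum>j\<in>V. A i j * ((v j)\<^sup>2 - v i * v j))" by simp
  also have "\<dots> = (\<Sum>i\<in>V. \<Sum>j\<in>V. A i j * (v i - v j)\<^sup>2)"
    unfolding sum.distrib[symmetric]
    by (intro sum.cong refl) (simp add: power2_eq_square algebra_simps)
  also have "\<dots> \<ge> 0" using assms(1) by (intro sum_nonneg mult_nonneg_nonneg) auto
  finally show ?thesis by simp
qed

text \<open>Reduces pair sums to the first two power sums, which traces determine in the case of
  eigenvalues; it serves eigenvalues and degrees alike.\<close>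

lemma sum_pairs_diff_sq:
  fixes f :: "'a \<Rightarrow> real"
  shows "(\<Sum>i\<in>V. \<Sum>j\<in>V. (f i - f j)\<^sup>2) = 2 * real (card V) * (\<Sum>i\<in>V. (f i)\<^sup>2) - 2 * (\<Sum>i\<in>V. f i)\<^sup>2"
proof -
  have "(f i - f j)\<^sup>2 = (f i)\<^sup>2 + (f j)\<^sup>2 - 2 * (f i * f j)" for i j
    by (simp add: power2_eq_square algebra_simps)
  thus ?thesis
    by (simp add: sum.distrib sum_subtractf power2_eq_square[of "sum f V"] sum_product
        flip: sum_distrib_left)
qed

lemma sum_squares_le_square_sum:
  fixes f :: "'a \<Rightarrow> real"
  assumes "finite V" "\<And>i. i \<in> V \<Longrightarrow> f i \<ge> 0"
  shows "(\<Sum>i\<in>V. (f i)\<^sup>2) \<le> (\<Sum>i\<in>V. f i)\<^sup>2"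
proof -
  have "(\<Sum>i\<in>V. (f i)\<^sup>2) \<le> (\<Sum>i\<in>V. f i * (\<Sum>j\<in>V. f j))"
    unfolding power2_eq_square using assms
    by (intro sum_mono mult_left_mono member_le_sum) auto
  thus ?thesis by (simp add: power2_eq_square sum_distrib_right)
qed

text \<open>Exchanging the two indices negates every summand, so the sum equals its own
  negative.\<close>

lemma sum_pairs_odd_power_diff:
  fixes f :: "'a \<Rightarrow> real"
  assumes "odd k"
  shows "(\<Sum>i\<in>V. \<Sum>j\<in>V. (f i - f j) ^ k) = 0" (is "?S = 0")
proof -
  have "?S = (\<Sum>i\<in>V. \<Sum>j\<in>V. (f j - f i) ^ k)" by (rule sum.swap)
  also have "\<dots> = (\<Sum>i\<in>V. \<Sum>j\<in>V. - ((f i - f j) ^ k))"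
    using assms by (intro sum.cong refl) (metis minus_diff_eq power_minus_odd)
  also have "\<dots> = - ?S" by (simp add: sum_negf)
  finally show ?thesis by simp
qed

section \<open>The weighted Laplacian\<close>

locale weighted_graph =
  fixes n :: nat and G :: "nat pair_pre_digraph" and w :: "nat \<Rightarrow> nat \<Rightarrow> real"
  assumes graph: "pair_graph G"
    and weights: "\<forall>(i, j) \<in> parcs G. w i j > 0 \<and> w i j = w j i"
begin

abbreviation "A i j \<equiv> adjacency_mat n G w $$ (i, j)"
abbreviation "d \<equiv> wdegree n G w"
abbreviation "L \<equiv> laplacian n G w"

lemma adjacency_nonneg: "i < n \<Longrightarrow> j < n \<Longrightarrow> A i j \<ge> 0"
  using weights by (fastforce simp: adjacency_mat_def)

lemma adjacency_sym:
  assumes "i < n" "j < n"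
  shows "A i j = A j i"
proof -
  interpret pair_graph G by (rule graph)
  have "(i, j) \<in> parcs G \<longleftrightarrow> (j, i) \<in> parcs G"
    using pair_sym_arcs by (auto simp: symmetric_def dest: symD)
  thus ?thesis using assms weights by (auto simp: adjacency_mat_def)
qed

lemma adjacency_diag: "i < n \<Longrightarrow> A i i = 0"
proof -
  interpret pair_graph G by (rule graph)
  show "i < n \<Longrightarrow> A i i = 0"
    using pair_no_loops[of "(i, i)"] by (auto simp: adjacency_mat_def)
qed

lemma laplacian_carrier [simp]: "L \<in> carrier_mat n n"
  by (simp add: laplacian_def adjacency_mat_def minus_carrier_mat)

lemma laplacian_index:
  "i < n \<Longrightarrow> j < n \<Longrightarrow> L $$ (i, j) = (if i = j then d i else 0) - A i j"
  by (simp add: laplacian_def degree_mat_def mat_diag_def adjacency_mat_def)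

lemma tr_degree_mat: "tr (degree_mat n G w) = (\<Sum>i<n. d i)"
  by (simp add: tr_def degree_mat_def mat_diag_def)

lemma tr_laplacian: "tr L = (\<Sum>i<n. d i)"
proof -
  have "dim_row L = n" using laplacian_carrier by blast
  thus ?thesis by (auto simp: tr_def laplacian_index adjacency_diag intro!: sum.cong)
qed

text \<open>The graph has no loops, so the cross terms of \<open>d i\<close> with
  \<open>A i i\<close> vanish; symmetry of the weights turns \<open>A i j * A j i\<close> into a
  square.\<close>

lemma tr_laplacian_sq: "tr (L * L) = (\<Sum>i<n. (d i)\<^sup>2) + (\<Sum>i<n. \<Sum>j<n. (A i j)\<^sup>2)"
proof -
  have "tr (L * L) = (\<Sum>i<n. \<Sum>j<n. L $$ (i, j) * L $$ (j, i))"
    using carrier_matD[OF laplacian_carrier]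
    by (auto simp: tr_def scalar_prod_def atLeast0LessThan intro!: sum.cong)
  also have "\<dots> = (\<Sum>i<n. \<Sum>j<n. (if j = i then (d i)\<^sup>2 else 0) + (A i j)\<^sup>2)"
    by (intro sum.cong refl)
      (auto simp: laplacian_index adjacency_diag power2_eq_square adjacency_sym)
  also have "\<dots> = (\<Sum>i<n. (d i)\<^sup>2) + (\<Sum>i<n. \<Sum>j<n. (A i j)\<^sup>2)"
    by (simp add: sum.distrib)
  finally show ?thesis .
qed

lemma sum_adjacency_sq_le: "(\<Sum>i<n. \<Sum>j<n. (A i j)\<^sup>2) \<le> (\<Sum>i<n. (d i)\<^sup>2)"
  unfolding wdegree_def
  by (intro sum_mono sum_squares_le_square_sum) (auto simp: adjacency_nonneg)

text \<open>Pairing the eigenvector equation with \<open>v\<close> equates \<open>k\<close> times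
  the positive squared norm of \<open>v\<close> with the nonnegative Laplacian form.\<close>

lemma laplacian_eigenvalue_nonneg:
  assumes "eigenvalue L k"
  shows "k \<ge> 0"
proof -
  have dims: "dim_row L = n" "dim_col L = n" using laplacian_carrier by blast+
  obtain v where v: "v \<in> carrier_vec n" "v \<noteq> 0\<^sub>v n" "L *\<^sub>v v = k \<cdot>\<^sub>v v"
    using assms by (auto simp: eigenvalue_def eigenvector_def dims)
  have row: "k * v $ i = (\<Sum>j<n. A i j * (v $ i - v $ j))" if i: "i < n" for i
  proof -
    have "k * v $ i = (L *\<^sub>v v) $ i" using v i by simp
    also have "\<dots> = (\<Sum>j<n. L $$ (i, j) * v $ j)"
      using i v(1) dims by (simp add: scalar_prod_def atLeast0LessThan)
    also have "\<dots> = (\<Sum>j<n. (if j = i then d i * v $ i else 0) - A i j * v $ j)"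
      using i by (intro sum.cong refl) (auto simp: laplacian_index algebra_simps)
    also have "\<dots> = (\<Sum>j<n. A i j * (v $ i - v $ j))"
      using i by (simp add: sum_subtractf wdegree_def sum_distrib_right right_diff_distrib)
    finally show ?thesis .
  qed
  have "k * (\<Sum>i<n. (v $ i)\<^sup>2) = (\<Sum>i<n. v $ i * (k * v $ i))"
    by (simp add: sum_distrib_left power2_eq_square mult_ac)
  also have "\<dots> = (\<Sum>i<n. \<Sum>j<n. A i j * ((v $ i)\<^sup>2 - v $ i * v $ j))"
    by (intro sum.cong refl)
      (simp add: row sum_distrib_left power2_eq_square algebra_simps)
  also have "\<dots> \<ge> 0"
    by (intro laplacian_form_nonneg) (auto simp: adjacency_nonneg intro: adjacency_sym)
  finally have le: "0 \<le> k * (\<Sum>i<n. (v $ i)\<^sup>2)" .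
  obtain i where "i < n" "v $ i \<noteq> 0"
    using v(1,2) by (metis carrier_vecD eq_vecI index_zero_vec)
  hence "0 < (\<Sum>i<n. (v $ i)\<^sup>2)" by (intro sum_pos2[of _ i]) auto
  with le show ?thesis by (simp add: zero_le_mult_iff)
qed

section \<open>Bounds for the Laplacian spectrum counted with multiplicity\<close>

context
  fixes ev :: "nat \<Rightarrow> real"
  assumes ev: "char_poly L = (\<Prod>i<n. [:- ev i, 1:])"
begin

lemma eigenvalue_bounds:
  assumes "i < n"
  shows "0 \<le> ev i" "ev i \<le> lambda_max L"
proof -
  note spec = spectrum_eq_image[OF laplacian_carrier ev]
  have "ev i \<in> spectrum L" using assms spec by simp
  thus "0 \<le> ev i" by (auto simp: spectrum_def intro: laplacian_eigenvalue_nonneg)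
  show "ev i \<le> lambda_max L" unfolding lambda_max_def spec using assms by simp
qed

lemma sum_pairs_eigenvalue_diff_sq_le:
  "(\<Sum>i<n. \<Sum>j<n. (ev i - ev j)\<^sup>2)
    \<le> (\<Sum>i<n. \<Sum>j<n. 2 * ((d i - d j)\<^sup>2 + (tr (degree_mat n G w))\<^sup>2 / (real n)\<^sup>2))"
proof -
  let ?t = "\<Sum>i<n. d i" and ?q = "\<Sum>i<n. (d i)\<^sup>2" and ?a = "\<Sum>i<n. \<Sum>j<n. (A i j)\<^sup>2"
  have "(\<Sum>i<n. \<Sum>j<n. (ev i - ev j)\<^sup>2) = 2 * real n * (?q + ?a) - 2 * ?t\<^sup>2"
    by (simp add: sum_pairs_diff_sq sum_eigenvalues_eq_tr[OF laplacian_carrier ev]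
        sum_eigenvalues_sq_eq_tr[OF laplacian_carrier ev] tr_laplacian tr_laplacian_sq)
  also have "\<dots> \<le> 2 * real n * (?q + ?q) - 2 * ?t\<^sup>2"
    using sum_adjacency_sq_le by (intro diff_right_mono mult_left_mono) auto
  \<comment> \<open>Regrouped as twice the pair sum of the degrees plus a remainder: this is the
    origin of the factor 2 and of the trace term.\<close>
  also have "\<dots> = 2 * (2 * real n * ?q - 2 * ?t\<^sup>2) + 2 * ?t\<^sup>2" by simp
  also have "2 * real n * ?q - 2 * ?t\<^sup>2 = (\<Sum>i<n. \<Sum>j<n. (d i - d j)\<^sup>2)"
    by (simp add: sum_pairs_diff_sq)
  \<comment> \<open>The remainder is spread evenly over the \<open>n^2\<close> pairs; for
    \<open>n = 0\<close> both sides are 0.\<close>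
  also have "2 * ?t\<^sup>2 = (\<Sum>i<n. \<Sum>j<n. 2 * (?t\<^sup>2 / (real n)\<^sup>2))"
    by (cases "n = 0") (simp_all add: power2_eq_square)
  finally show ?thesis
    by (simp add: tr_degree_mat sum.distrib sum_distrib_left distrib_left)
qed

text \<open>Two factors of each difference are kept and the other \<open>2 * k\<close> are bounded
  by the length of the interval containing the spectrum. For \<open>k = 0\<close> the bound has
  factor 1 even when \<open>lambda_max L = 0\<close>.\<close>

lemma sum_pairs_eigenvalue_even_power_le:
  "(\<Sum>i<n. \<Sum>j<n. (ev i - ev j) ^ (2 * Suc k))
    \<le> lambda_max L ^ (2 * k) * (\<Sum>i<n. \<Sum>j<n. (ev i - ev j)\<^sup>2)"
proof -
  have "(ev i - ev j) ^ (2 * Suc k) \<le> lambda_max L ^ (2 * k) * (ev i - ev j)\<^sup>2"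
    if "i < n" "j < n" for i j
  proof -
    have "\<bar>ev i - ev j\<bar> \<le> lambda_max L"
      using eigenvalue_bounds[OF that(1)] eigenvalue_bounds[OF that(2)] by linarith
    hence "\<bar>ev i - ev j\<bar> ^ (2 * k) \<le> lambda_max L ^ (2 * k)" by (intro power_mono) auto
    hence "(ev i - ev j) ^ (2 * k) \<le> lambda_max L ^ (2 * k)" by (simp add: power_even_abs)
    moreover have "(ev i - ev j) ^ (2 * Suc k) = (ev i - ev j) ^ (2 * k) * (ev i - ev j)\<^sup>2"
      by (simp add: power_add[symmetric])
    ultimately show ?thesis by (simp only: mult_right_mono zero_le_power2)
  qed
  thus ?thesis by (auto simp: sum_distrib_left intro!: sum_mono)
qed

end

end

section \<open>Analyticity and convergence\<close>

lemma real_analytic2_const: "real_analytic2 (\<lambda>_. C)"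
  unfolding real_analytic2_def
proof (intro allI exI conjI impI)
  fix x0 y0 x y :: real
  show "(0::real) < 1" by simp
  show "((\<lambda>(i, j). (\<lambda>i j. if i = 0 \<and> j = 0 then C else 0) i j * (x - x0) ^ i * (y - y0) ^ j)
      has_sum C) UNIV"
    by (rule has_sum_finite_neutralI[where B = "{(0, 0)}"]) (auto split: if_splits)
qed

lemma real_analytic2_quadratic: "real_analytic2 (\<lambda>(x, y). p + q * (x - y)\<^sup>2)"
  unfolding real_analytic2_def
proof (intro allI exI conjI impI)
  fix x0 y0 x y :: real
  \<comment> \<open>Coefficients from expanding the square of
    \<open>(x0 - y0) + (x - x0) - (y - y0)\<close>; only finitely many are nonzero, so any radius
    works and 1 is taken.\<close>
  let ?c = "\<lambda>i j :: nat.
    if (i, j) = (0, 0) then p + q * (x0 - y0)\<^sup>2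
    else if (i, j) = (1, 0) then 2 * q * (x0 - y0)
    else if (i, j) = (0, 1) then - 2 * q * (x0 - y0)
    else if (i, j) = (2, 0) \<or> (i, j) = (0, 2) then q
    else if (i, j) = (1, 1) then - 2 * q
    else 0"
  show "(0::real) < 1" by simp
  show "((\<lambda>(i, j). ?c i j * (x - x0) ^ i * (y - y0) ^ j)
      has_sum (case (x, y) of (x, y) \<Rightarrow> p + q * (x - y)\<^sup>2)) UNIV"
    by (rule has_sum_finite_neutralI[where B = "{(0, 0), (1, 0), (0, 1), (2, 0), (0, 2), (1, 1)}"])
      (auto split: if_splits simp: power2_eq_square algebra_simps)
qed

text \<open>A power series that converges everywhere converges absolutely, so its even terms can be
  extracted.\<close>

lemma summable_even_shifted_powers:
  fixes c :: "nat \<Rightarrow> real"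
  assumes "\<And>x. summable (\<lambda>k. c k * x ^ k)"
  shows "summable (\<lambda>k. c (2 * Suc k) * x ^ (2 * k))"
proof -
  \<comment> \<open>The coefficient index exceeds the exponent by 2; \<open>M \<ge> 1\<close>
    ensures that adding 2 to the exponent does not decrease the power.\<close>
  define M where "M = max 1 \<bar>x\<bar>"
  have M: "1 \<le> M" "\<bar>x\<bar> \<le> M" by (auto simp: M_def)
  have "summable (\<lambda>k. norm (c k * M ^ k))"
    using M by (intro powser_insidea[OF assms[of "M + 1"]]) auto
  moreover have "inj (\<lambda>k. 2 * Suc k)" by (auto simp: inj_def)
  ultimately have "summable (\<lambda>k. norm (c (2 * Suc k) * M ^ (2 * Suc k)))"
    using summable_reindex[of "\<lambda>k. norm (c k * M ^ k)" "\<lambda>k. 2 * Suc k"] by (simp add: o_def)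
  moreover have "norm (c (2 * Suc k) * x ^ (2 * k)) \<le> norm (c (2 * Suc k) * M ^ (2 * Suc k))" for k
  proof -
    have "\<bar>x\<bar> ^ (2 * k) \<le> M ^ (2 * k)" using M by (intro power_mono) auto
    also have "\<dots> \<le> M ^ (2 * Suc k)" using M by (intro power_increasing) auto
    finally show ?thesis using M by (simp add: abs_mult power_abs mult_left_mono del: mult_Suc_right power_Suc)
  qed
  ultimately show ?thesis by (rule summable_comparison_test'[where N = 0])
qed

theorem proposition3:
  fixes n :: nat
    and G :: "nat pair_pre_digraph"
    and w :: "nat \<Rightarrow> nat \<Rightarrow> real"
    and L D :: "real mat"
    and d ev :: "nat \<Rightarrow> real"
    and g :: "real \<times> real \<Rightarrow> real"
  assumes "pair_graph G"
    and "pverts G = {..<n}"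
    and "Digraph_Component.connected (with_proj G)"
    and "\<forall>(i, j) \<in> parcs G. w i j > 0 \<and> w i j = w j i"
    and L: "L = laplacian n G w"
    and D: "D = degree_mat n G w"
    and d: "d = wdegree n G w"
    and ev: "char_poly L = (\<Prod>i<n. [:- ev i, 1:])"
  shows
    "(real_analytic2 g \<longrightarrow>
       (\<exists>g'. real_analytic2 g' \<and>
         (\<Sum>i<n. \<Sum>j<n. g (ev i, ev j)) \<le> (\<Sum>i<n. \<Sum>j<n. g' (d i, d j)))) \<and>
     (\<forall>a :: nat \<Rightarrow> real.
       (\<forall>x y. (\<lambda>k. a k / fact k * (x - y) ^ k) sums g (x, y)) \<longrightarrow>
       (\<forall>k\<ge>1. a (2 * k) \<ge> 0) \<longrightarrow>
       (\<exists>g'. real_analytic2 g' \<and>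
         (\<forall>x y. \<exists>s.
            (\<lambda>k. a (2 * Suc k) / fact (2 * Suc k) * lambda_max L ^ (2 * Suc k - 2)
                  * ((x - y)\<^sup>2 + (tr D)\<^sup>2 / (real n)\<^sup>2)) sums s \<and>
            g' (x, y) = a 0 + 2 * s) \<and>
         (\<Sum>i<n. \<Sum>j<n. g (ev i, ev j)) \<le> (\<Sum>i<n. \<Sum>j<n. g' (d i, d j))))"
proof (intro conjI impI allI)
  let ?S = "\<Sum>i<n. \<Sum>j<n. g (ev i, ev j)"
  \<comment> \<open>The constant witness is the average over the \<open>n^2\<close> pairs; for
    \<open>n = 0\<close> both sums are empty.\<close>
  have "?S \<le> (\<Sum>i<n. \<Sum>j<n. ?S / (real n)\<^sup>2)"
    by (cases "n = 0") (simp_all add: power2_eq_square)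
  thus "\<exists>g'. real_analytic2 g' \<and> ?S \<le> (\<Sum>i<n. \<Sum>j<n. g' (d i, d j))"
    using real_analytic2_const[of "?S / (real n)\<^sup>2"]
    by (intro exI[of _ "\<lambda>_. ?S / (real n)\<^sup>2"]) simp
next
  fix a :: "nat \<Rightarrow> real"
  assume g: "\<forall>x y. (\<lambda>k. a k / fact k * (x - y) ^ k) sums g (x, y)"
    and a: "\<forall>k\<ge>1. a (2 * k) \<ge> 0"
  interpret graph: weighted_graph n G w using assms(1,4) by (rule weighted_graph.intro)
  have ev': "char_poly (laplacian n G w) = (\<Prod>i<n. [:- ev i, 1:])" using ev L by simp
  let ?S = "\<Sum>i<n. \<Sum>j<n. g (ev i, ev j)"
  \<comment> \<open>Index shifted by one: \<open>b k\<close> belongs to the power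
    \<open>2 * k + 2\<close>, so the exponent of \<open>l\<close> is simply
    \<open>2 * k\<close>.\<close>
  define b where "b k = a (2 * Suc k) / fact (2 * Suc k)" for k
  define l where "l = lambda_max L"
  define r where "r x y = (x - y)\<^sup>2 + (tr D)\<^sup>2 / (real n)\<^sup>2" for x y :: real
  define T where "T = (\<Sum>k. b k * l ^ (2 * k))"
  define h where "h k = a k / fact k * (\<Sum>i<n. \<Sum>j<n. (ev i - ev j) ^ k)" for k
  have b: "b k \<ge> 0" for k using a[rule_format, of "Suc k"] unfolding b_def by (intro divide_nonneg_pos) auto
  \<comment> \<open>Setting \<open>y = 0\<close> in the series of \<open>g\<close> yields an
    everywhere convergent power series.\<close>
  have "summable (\<lambda>k. a k / fact k * x ^ k)" for x
    using g[rule_format, of x 0] by (simp add: sums_iff)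
  hence "summable (\<lambda>k. b k * l ^ (2 * k))"
    unfolding b_def by (rule summable_even_shifted_powers)
  hence T: "(\<lambda>k. b k * l ^ (2 * k)) sums T" unfolding T_def by (rule summable_sums)

  have "h sums ?S"
    unfolding h_def sum_distrib_left using g by (intro sums_sum) auto
  moreover have "h k = 0" if "k \<notin> range ((*) 2)" for k
  proof -
    have "odd k" using that by (auto elim!: evenE)
    thus ?thesis by (simp add: h_def sum_pairs_odd_power_diff)
  qed
  ultimately have "(\<lambda>k. h (2 * k)) sums ?S"
    by (subst sums_mono_reindex) (auto simp: strict_mono_def)
  \<comment> \<open>The term \<open>h 0\<close>, equal to \<open>a 0 * n^2\<close> because
    \<open>0 ^ 0 = 1\<close>, is split off: the sign condition and the power bound concern positive
    even indices.\<close>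
  hence "(\<lambda>k. h (2 * Suc k)) sums (?S - h 0)"
    by (subst sums_Suc_iff) simp
  moreover have "(\<lambda>k. b k * l ^ (2 * k) * (\<Sum>i<n. \<Sum>j<n. 2 * r (d i) (d j)))
      sums (T * (\<Sum>i<n. \<Sum>j<n. 2 * r (d i) (d j)))"
    using T by (rule sums_mult2)
  \<comment> \<open>The comparison is termwise: even powers are traded for squares, then eigenvalues
    for degrees, using that \<open>b k\<close> and \<open>l ^ (2 * k)\<close> are
    nonnegative.\<close>
  moreover have "h (2 * Suc k) \<le> b k * l ^ (2 * k) * (\<Sum>i<n. \<Sum>j<n. 2 * r (d i) (d j))" for k
  proof -
    have "h (2 * Suc k) \<le> b k * (l ^ (2 * k) * (\<Sum>i<n. \<Sum>j<n. (ev i - ev j)\<^sup>2))"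
      unfolding h_def b_def[symmetric] l_def L using b
      by (intro mult_left_mono graph.sum_pairs_eigenvalue_even_power_le[OF ev'])
    also have "\<dots> \<le> b k * (l ^ (2 * k) * (\<Sum>i<n. \<Sum>j<n. 2 * r (d i) (d j)))"
      unfolding r_def D d using b
      by (intro mult_left_mono graph.sum_pairs_eigenvalue_diff_sq_le[OF ev']) auto
    finally show ?thesis by (simp add: mult.assoc)
  qed
  ultimately have le: "?S - h 0 \<le> T * (\<Sum>i<n. \<Sum>j<n. 2 * r (d i) (d j))"
    by (rule sums_le[rotated])

  let ?g = "\<lambda>(x, y). a 0 + 2 * (T * r x y)"
  \<comment> \<open>The bracket \<open>r x y\<close> does not depend on \<open>k\<close>, so the
    series contributes only the number \<open>T\<close> and \<open>?g\<close> is a quadratic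
    polynomial.\<close>
  have "?g = (\<lambda>(x, y). (a 0 + 2 * T * (tr D)\<^sup>2 / (real n)\<^sup>2) + (2 * T) * (x - y)\<^sup>2)"
    by (auto simp: r_def algebra_simps)
  hence "real_analytic2 ?g" by (simp only: real_analytic2_quadratic)
  moreover have "\<exists>s. (\<lambda>k. a (2 * Suc k) / fact (2 * Suc k) * lambda_max L ^ (2 * Suc k - 2)
        * ((x - y)\<^sup>2 + (tr D)\<^sup>2 / (real n)\<^sup>2)) sums s \<and> ?g (x, y) = a 0 + 2 * s" for x y
    using sums_mult2[OF T, of "r x y"]
    by (intro exI[of _ "T * r x y"]) (simp add: b_def l_def r_def)
  \<comment> \<open>Distributing \<open>h 0\<close> over the \<open>n^2\<close> pairs gives back the
    summand \<open>a 0\<close> of \<open>?g\<close>.\<close>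
  moreover have "?S \<le> (\<Sum>i<n. \<Sum>j<n. ?g (d i, d j))"
    using le by (simp add: h_def sum.distrib sum_distrib_left mult_ac)
  ultimately show "\<exists>g'. real_analytic2 g' \<and>
      (\<forall>x y. \<exists>s. (\<lambda>k. a (2 * Suc k) / fact (2 * Suc k) * lambda_max L ^ (2 * Suc k - 2)
            * ((x - y)\<^sup>2 + (tr D)\<^sup>2 / (real n)\<^sup>2)) sums s \<and> g' (x, y) = a 0 + 2 * s) \<and>
      ?S \<le> (\<Sum>i<n. \<Sum>j<n. g' (d i, d j))"
    by blast
qed

end
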